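(* Let $F_1$ and $F_2$ be two fields containing an algebraically closed field $K$. Let $A$ and $B$ be two $K$-algebras of finite dimension. Then $A_{F_1}$ and $B_{F_1}$ are isomorphic as $F_1$-algebras if and only if $A_{F_2}$ and $B_{F_2}$ are isomorphic as $F_2$-algebras.
   Context: Algebras are not necessarily associative, commutative or unital. For a $K$-algebra $A$ and a field extension $K\subseteq F$, $A_F:=A\otimes_K F$, regarded as an $F$-algebra. *)

theory Defs
  imports "HOL-Computational_Algebra.Polynomial" "HOL-Library.Poly_Mapping"
begin

section \<open>Fields and algebras\<close>

text \<open>
  A field extension \<open>K \<subseteq> F\<close> is given by a ring homomorphism \<open>\<iota>\<close> between the two field types;
  it is injective, see \<open>inj\<close> below.
\<close>

locale field_embedding =
  fixes \<iota> :: "'k::field \<Rightarrow> 'f::field"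
  assumes one: "\<iota> 1 = 1"
    and add: "\<iota> (x + y) = \<iota> x + \<iota> y"
    and mult: "\<iota> (x * y) = \<iota> x * \<iota> y"
begin

lemma inj: "inj \<iota>"
proof (rule injI)
  fix x y
  assume eq: "\<iota> x = \<iota> y"
  have "\<iota> x = \<iota> (x - y) + \<iota> y"
    using add[of "x - y" y] by simp
  with eq have zero: "\<iota> (x - y) = 0"
    by simp
  show "x = y"
  proof (rule ccontr)
    assume "x \<noteq> y"
    then have "\<iota> (x - y) * \<iota> (inverse (x - y)) = 1"
      using one by (simp flip: mult)
    with zero show False
      by simp
  qed
qed

end

text \<open>
  Algebras need not be associative, commutative or unital: an algebra is a vector space with a
  bilinear product.
\<close>

locale nonassoc_algebra = vector_space scale
  for scale :: "'k::field \<Rightarrow> 'a::ab_group_add \<Rightarrow> 'a" +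
  fixes mul :: "'a \<Rightarrow> 'a \<Rightarrow> 'a"
  assumes mul_add_left: "mul (x + y) z = mul x z + mul y z"
    and mul_add_right: "mul x (y + z) = mul x y + mul x z"
    and mul_scale_left: "mul (scale c x) y = scale c (mul x y)"
    and mul_scale_right: "mul x (scale c y) = scale c (mul x y)"

definition finite_dimensional :: "('k::field \<Rightarrow> 'a::ab_group_add \<Rightarrow> 'a) \<Rightarrow> bool" where
  "finite_dimensional scale \<longleftrightarrow> (\<exists>Basis. finite_dimensional_vector_space scale Basis)"


section \<open>Tensor products of vector spaces\<close>

text \<open>
  \<open>V \<otimes>\<^sub>K W\<close> is the free abelian group on \<open>V \<times> W\<close> (the type \<open>'v \<times> 'w \<Rightarrow>\<^sub>0 int\<close>) modulo the subgroup
  \<open>tensor_null\<close> generated by the usual relations. Since the subgroup depends on the scalar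
  multiplications, the quotient is a set of cosets rather than a type.
\<close>

inductive_set tensor_null ::
  "('k \<Rightarrow> 'v \<Rightarrow> 'v) \<Rightarrow> ('k \<Rightarrow> 'w \<Rightarrow> 'w) \<Rightarrow> ('v::ab_group_add \<times> 'w::ab_group_add \<Rightarrow>\<^sub>0 int) set"
  for sV :: "'k \<Rightarrow> 'v \<Rightarrow> 'v" and sW :: "'k \<Rightarrow> 'w \<Rightarrow> 'w" where
  add_left: "frag_of (v + v', w) - frag_of (v, w) - frag_of (v', w) \<in> tensor_null sV sW"
| add_right: "frag_of (v, w + w') - frag_of (v, w) - frag_of (v, w') \<in> tensor_null sV sW"
| balanced: "frag_of (sV c v, w) - frag_of (v, sW c w) \<in> tensor_null sV sW"
| zero: "0 \<in> tensor_null sV sW"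
| diff: "x \<in> tensor_null sV sW \<Longrightarrow> y \<in> tensor_null sV sW \<Longrightarrow> x - y \<in> tensor_null sV sW"

definition tensor_rel ::
  "('k \<Rightarrow> 'v \<Rightarrow> 'v) \<Rightarrow> ('k \<Rightarrow> 'w \<Rightarrow> 'w) \<Rightarrow> ('v::ab_group_add \<times> 'w::ab_group_add \<Rightarrow>\<^sub>0 int) rel" where
  "tensor_rel sV sW = {(x, y). x - y \<in> tensor_null sV sW}"

lemma tensor_null_uminus: "x \<in> tensor_null sV sW \<Longrightarrow> - x \<in> tensor_null sV sW"
  using tensor_null.diff[OF tensor_null.zero] by fastforce

lemma tensor_null_add:
  assumes "x \<in> tensor_null sV sW" "y \<in> tensor_null sV sW"
  shows "x + y \<in> tensor_null sV sW"
  using tensor_null.diff[OF assms(1) tensor_null_uminus[OF assms(2)]] by simp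

lemma equiv_tensor_rel: "equiv UNIV (tensor_rel sV sW)"
proof (rule equivI)
  show "refl (tensor_rel sV sW)"
    by (simp add: refl_on_def tensor_rel_def tensor_null.zero)
  show "sym (tensor_rel sV sW)"
    unfolding sym_def tensor_rel_def using tensor_null_uminus by fastforce
  show "trans (tensor_rel sV sW)"
    unfolding trans_def tensor_rel_def using tensor_null_add by fastforce
qed simp


section \<open>Extension of scalars\<close>

text \<open>An algebra whose elements form a set; used for the algebras \<open>A \<otimes>\<^sub>K F\<close>.\<close>

record ('f, 't) algebra_on =
  elems :: "'t set"
  alg_add :: "'t \<Rightarrow> 't \<Rightarrow> 't"
  alg_scale :: "'f \<Rightarrow> 't \<Rightarrow> 't"
  alg_prod :: "'t \<Rightarrow> 't \<Rightarrow> 't"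

text \<open>On formal sums: \<open>h \<cdot> (a \<otimes> f) = a \<otimes> (h f)\<close> and \<open>(a \<otimes> f) (b \<otimes> g) = a b \<otimes> f g\<close>.\<close>

definition formal_scale :: "'f::field \<Rightarrow> ('a \<times> 'f \<Rightarrow>\<^sub>0 int) \<Rightarrow> ('a \<times> 'f \<Rightarrow>\<^sub>0 int)" where
  "formal_scale h x = frag_extend (\<lambda>(a, f). frag_of (a, h * f)) x"

definition formal_prod ::
  "('a \<Rightarrow> 'a \<Rightarrow> 'a) \<Rightarrow> ('a \<times> 'f::field \<Rightarrow>\<^sub>0 int) \<Rightarrow> ('a \<times> 'f \<Rightarrow>\<^sub>0 int) \<Rightarrow> ('a \<times> 'f \<Rightarrow>\<^sub>0 int)" where
  "formal_prod mul x y =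
     frag_extend (\<lambda>(a, f). frag_extend (\<lambda>(b, g). frag_of (mul a b, f * g)) y) x"

text \<open>
  The \<open>F\<close>-algebra \<open>A\<^sub>F = A \<otimes>\<^sub>K F\<close>, where \<open>K\<close> acts on \<open>F\<close> through \<open>\<iota>\<close>. The operations on cosets are
  induced by those on representatives; they are well defined by the lemmas that follow.
\<close>

definition scalar_extension ::
  "('k::field \<Rightarrow> 'f::field) \<Rightarrow> ('k \<Rightarrow> 'a::ab_group_add \<Rightarrow> 'a) \<Rightarrow> ('a \<Rightarrow> 'a \<Rightarrow> 'a) \<Rightarrow>
   ('f, ('a \<times> 'f \<Rightarrow>\<^sub>0 int) set) algebra_on" where
  "scalar_extension \<iota> scale mul =
     (let R = tensor_rel scale (\<lambda>c f. \<iota> c * f) in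
      \<lparr>elems = UNIV // R,
       alg_add = (\<lambda>X Y. \<Union>x\<in>X. \<Union>y\<in>Y. R `` {x + y}),
       alg_scale = (\<lambda>h X. \<Union>x\<in>X. R `` {formal_scale h x}),
       alg_prod = (\<lambda>X Y. \<Union>x\<in>X. \<Union>y\<in>Y. R `` {formal_prod mul x y})\<rparr>)"

definition algebra_isomorphic ::
  "('f, 's) algebra_on \<Rightarrow> ('f, 't) algebra_on \<Rightarrow> bool" where
  "algebra_isomorphic A B \<longleftrightarrow>
     (\<exists>\<phi>. bij_betw \<phi> (elems A) (elems B) \<and>
          (\<forall>x\<in>elems A. \<forall>y\<in>elems A. \<phi> (alg_add A x y) = alg_add B (\<phi> x) (\<phi> y)) \<and>
          (\<forall>c. \<forall>x\<in>elems A. \<phi> (alg_scale A c x) = alg_scale B c (\<phi> x)) \<and>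
          (\<forall>x\<in>elems A. \<forall>y\<in>elems A. \<phi> (alg_prod A x y) = alg_prod B (\<phi> x) (\<phi> y)))"


subsection \<open>The operations are well defined\<close>

lemma frag_extend_in_tensor_null:
  assumes "\<And>p. g p \<in> tensor_null sV sW"
  shows "frag_extend g x \<in> tensor_null sV sW"
  using subset_UNIV[of "Poly_Mapping.keys x"]
  by (induction x rule: frag_induction)
    (auto simp: frag_extend_diff assms intro: tensor_null.intros)

lemma frag_extend_fun_diff: "frag_extend (\<lambda>p. g p - h p) x = frag_extend g x - frag_extend h x"
  using subset_UNIV[of "Poly_Mapping.keys x"]
  by (induction x rule: frag_induction) (auto simp: frag_extend_diff)

lemma tensor_add_respects: "(\<lambda>x y. tensor_rel sV sW `` {x + y}) respects2 tensor_rel sV sW"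
proof (rule congruent2I', rule equiv_class_eq[OF equiv_tensor_rel])
  fix x x' y y'
  assume "(x, x') \<in> tensor_rel sV sW" "(y, y') \<in> tensor_rel sV sW"
  then show "(x + y, x' + y') \<in> tensor_rel sV sW"
    using tensor_null_add[of "x - x'" sV sW "y - y'"] by (simp add: tensor_rel_def algebra_simps)
qed

lemma formal_scale_null:
  assumes "x \<in> tensor_null scale (\<lambda>c f. \<iota> c * f)"
  shows "formal_scale h x \<in> tensor_null scale (\<lambda>c f. \<iota> c * f)"
  using assms
proof induction
  case (balanced c v w)
  show ?case
    using tensor_null.balanced[of scale c v "h * w" "\<lambda>c f. \<iota> c * f"]
    by (simp add: formal_scale_def frag_extend_diff mult.left_commute)
qed (simp_all add: formal_scale_def frag_extend_diff distrib_left tensor_null.intros)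

lemma tensor_scale_respects:
  fixes \<iota> :: "'k \<Rightarrow> 'f::field"
    and scale :: "'k \<Rightarrow> 'a::ab_group_add \<Rightarrow> 'a"
  defines "R \<equiv> tensor_rel scale (\<lambda>c f. \<iota> c * f)"
  shows "(\<lambda>x. R `` {formal_scale h x}) respects R"
proof (rule congruentI)
  fix x y
  assume "(x, y) \<in> R"
  then have "(formal_scale h x, formal_scale h y) \<in> R"
    using formal_scale_null[of "x - y" scale \<iota> h]
    by (simp add: R_def tensor_rel_def formal_scale_def frag_extend_diff)
  then show "R `` {formal_scale h x} = R `` {formal_scale h y}"
    unfolding R_def by (rule equiv_class_eq[OF equiv_tensor_rel])
qed

context nonassoc_algebra
begin

lemma formal_prod_null_left:
  fixes \<iota> :: "'k \<Rightarrow> 'f::field"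
  assumes "x \<in> tensor_null scale (\<lambda>c f. \<iota> c * f)"
  shows "formal_prod mul x y \<in> tensor_null scale (\<lambda>c f. \<iota> c * f)"
  using assms
proof induction
  case (diff x x')
  then show ?case
    by (simp add: formal_prod_def frag_extend_diff tensor_null.diff)
next
  case (balanced c v w)
  show ?case
    using tensor_null.balanced[of scale c _ _ "\<lambda>c f. \<iota> c * f"]
    by (simp add: formal_prod_def frag_extend_diff mult.assoc mul_scale_left split_def
        frag_extend_in_tensor_null flip: frag_extend_fun_diff)
qed (simp_all add: formal_prod_def frag_extend_diff split_def distrib_right mul_add_left
      frag_extend_in_tensor_null tensor_null.intros flip: frag_extend_fun_diff)

lemma formal_prod_null_right:
  fixes \<iota> :: "'k \<Rightarrow> 'f::field"
  assumes "y \<in> tensor_null scale (\<lambda>c f. \<iota> c * f)"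
  shows "formal_prod mul x y \<in> tensor_null scale (\<lambda>c f. \<iota> c * f)"
proof -
  have "frag_extend (\<lambda>(b, g). frag_of (mul a b, f * g)) y \<in> tensor_null scale (\<lambda>c f. \<iota> c * f)"
    for a and f :: 'f
    using assms
  proof induction
    case (balanced c v w)
    show ?case
      using tensor_null.balanced[of scale c "mul a v" "f * w" "\<lambda>c f. \<iota> c * f"]
      by (simp add: frag_extend_diff mult.left_commute mul_scale_right)
  qed (simp_all add: frag_extend_diff distrib_left mul_add_right tensor_null.intros)
  then show ?thesis
    unfolding formal_prod_def by (intro frag_extend_in_tensor_null) auto
qed

lemma tensor_prod_respects:
  fixes \<iota> :: "'k \<Rightarrow> 'f::field"
  defines "R \<equiv> tensor_rel scale (\<lambda>c f. \<iota> c * f)"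
  shows "(\<lambda>x y. R `` {formal_prod mul x y}) respects2 R"
proof (rule congruent2I')
  fix x x' y y'
  assume *: "(x, x') \<in> R" "(y, y') \<in> R"
  have "formal_prod mul x y - formal_prod mul x' y' =
      formal_prod mul (x - x') y + formal_prod mul x' (y - y')"
    by (simp add: formal_prod_def frag_extend_diff split_def frag_extend_fun_diff)
  then have "(formal_prod mul x y, formal_prod mul x' y') \<in> R"
    using * formal_prod_null_left[of "x - x'" \<iota> y] formal_prod_null_right[of "y - y'" \<iota> x']
    by (simp add: R_def tensor_rel_def tensor_null_add)
  then show "R `` {formal_prod mul x y} = R `` {formal_prod mul x' y'}"
    unfolding R_def by (rule equiv_class_eq[OF equiv_tensor_rel])
qed

end

end

theory Submission
  imports Defs
begin

text \<open>
  Both sides of the equivalence say that \<open>A\<close> and \<open>B\<close> are already isomorphic over \<open>K\<close>, and the two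
  fields never have to be compared with each other.

  Choose bases of \<open>A\<close> and \<open>B\<close>. They are also bases of \<open>A\<^sub>F\<close> and \<open>B\<^sub>F\<close>, with the same structure
  constants, which lie in \<open>K\<close>. An isomorphism \<open>A\<^sub>F \<rightarrow> B\<^sub>F\<close> is therefore a pair of mutually inverse
  matrices over \<open>F\<close> whose entries satisfy finitely many polynomial equations with coefficients in
  \<open>K\<close>. Such a solution over \<open>K\<close> is in particular one over \<open>F\<close>. Conversely, the entries of a solution
  over \<open>F\<close> generate a finitely generated \<open>K\<close>-algebra inside \<open>F\<close>; since \<open>K\<close> is algebraically closed,
  this algebra has a homomorphism to \<open>K\<close> that is the identity on \<open>K\<close> (\<open>specialization_exists\<close>), and it
  carries the solution over \<open>F\<close> to one over \<open>K\<close>. Taking the inverse matrix along with the matrix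
  replaces any condition on determinants: invertibility becomes part of the equations. The result is
  \<open>scalar_extensions_isomorphic_iff\<close>, whose right-hand side does not mention \<open>F\<close>.

  The homomorphism to \<open>K\<close> is built by adjoining one generator at a time. The key point
  (\<open>extension_condition\<close>) is that, for \<open>s \<noteq> 0\<close> in \<open>R[t]\<close>, a homomorphism \<open>R \<rightarrow> K\<close> extends to \<open>R[t]\<close>
  without killing \<open>s\<close> unless it kills a certain nonzero element \<open>r\<close> of \<open>R\<close>. The proof uses only
  division with remainder in \<open>R[X]\<close>.
\<close>

section \<open>Specialising elements of an extension field\<close>

text \<open>Otherwise \<open>1 + X p\<close> would be a nonconstant polynomial that is constantly \<open>1\<close>.\<close>

lemma exists_nonroot:
  fixes p :: "'k::alg_closed_field poly"
  assumes "p \<noteq> 0"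
  shows "\<exists>x. poly p x \<noteq> 0"
proof (rule ccontr)
  assume "\<not> ?thesis"
  then have zero: "poly p x = 0" for x
    by simp
  obtain x where "poly (pCons 1 p) x = 0"
    using alg_closed_imp_poly_has_root[of "pCons 1 p"] assms by auto
  with zero[of x] show False
    by simp
qed

definition poly_over :: "'f::zero set \<Rightarrow> 'f poly set" where
  "poly_over R = {p. \<forall>i. coeff p i \<in> R}"

definition adjoin :: "'f::comm_ring_1 set \<Rightarrow> 'f \<Rightarrow> 'f set" where
  "adjoin R t = (\<lambda>p. poly p t) ` poly_over R"

text \<open>Subrings of \<open>F\<close> and their homomorphisms are kept as sets and as total functions with conditions on a
  set, because the ring grows in the course of the argument while the ambient type stays the same.\<close>

definition ring_hom_on :: "'f::ring_1 set \<Rightarrow> ('f \<Rightarrow> 'k::ring_1) \<Rightarrow> bool" where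
  "ring_hom_on R \<phi> \<longleftrightarrow> \<phi> 1 = 1 \<and>
     (\<forall>x\<in>R. \<forall>y\<in>R. \<phi> (x + y) = \<phi> x + \<phi> y) \<and> (\<forall>x\<in>R. \<forall>y\<in>R. \<phi> (x * y) = \<phi> x * \<phi> y)"

locale unital_subring =
  fixes R :: "'f::field set"
  assumes one_closed: "1 \<in> R"
    and diff_closed: "x \<in> R \<Longrightarrow> y \<in> R \<Longrightarrow> x - y \<in> R"
    and mult_closed: "x \<in> R \<Longrightarrow> y \<in> R \<Longrightarrow> x * y \<in> R"
begin

lemma zero_closed: "0 \<in> R"
  using diff_closed[OF one_closed one_closed] by simp

lemma add_closed: "x \<in> R \<Longrightarrow> y \<in> R \<Longrightarrow> x + y \<in> R"
  using diff_closed[of x "0 - y"] diff_closed[of 0 y] zero_closed by simp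

lemma sum_closed: "(\<And>i. i \<in> I \<Longrightarrow> f i \<in> R) \<Longrightarrow> sum f I \<in> R"
  by (induction I rule: infinite_finite_induct) (auto simp: zero_closed add_closed)

lemma power_closed: "x \<in> R \<Longrightarrow> x ^ n \<in> R"
  by (induction n) (auto simp: one_closed mult_closed)

lemma poly_over_add: "p \<in> poly_over R \<Longrightarrow> q \<in> poly_over R \<Longrightarrow> p + q \<in> poly_over R"
  and poly_over_diff: "p \<in> poly_over R \<Longrightarrow> q \<in> poly_over R \<Longrightarrow> p - q \<in> poly_over R"
  and poly_over_mult: "p \<in> poly_over R \<Longrightarrow> q \<in> poly_over R \<Longrightarrow> p * q \<in> poly_over R"
  and poly_over_smult: "c \<in> R \<Longrightarrow> p \<in> poly_over R \<Longrightarrow> smult c p \<in> poly_over R"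
  and poly_over_monom: "c \<in> R \<Longrightarrow> monom c n \<in> poly_over R"
  and poly_over_pCons: "c \<in> R \<Longrightarrow> p \<in> poly_over R \<Longrightarrow> pCons c p \<in> poly_over R"
  and poly_over_0: "0 \<in> poly_over R"
  by (auto simp: poly_over_def add_closed diff_closed mult_closed coeff_mult zero_closed
      coeff_pCons intro!: sum_closed split: nat.splits)

lemma unital_subring_adjoin: "unital_subring (adjoin R t)"
proof
  show "1 \<in> adjoin R t"
    unfolding adjoin_def
    by (rule image_eqI[of _ _ "[:1:]"]) (auto intro: poly_over_pCons poly_over_0 one_closed)
  fix x y
  assume "x \<in> adjoin R t" "y \<in> adjoin R t"
  then obtain p q where pq: "p \<in> poly_over R" "q \<in> poly_over R" "x = poly p t" "y = poly q t"
    by (auto simp: adjoin_def)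
  show "x - y \<in> adjoin R t" "x * y \<in> adjoin R t"
    using pq poly_over_diff[of p q] poly_over_mult[of p q]
    by (auto simp: adjoin_def intro: image_eqI[of _ _ "p - q"] image_eqI[of _ _ "p * q"])
qed

lemma subset_adjoin: "R \<subseteq> adjoin R t"
proof
  fix c
  assume "c \<in> R"
  then show "c \<in> adjoin R t"
    unfolding adjoin_def
    by (intro image_eqI[of _ _ "[:c:]"]) (auto intro: poly_over_pCons poly_over_0)
qed

lemma generator_in_adjoin: "t \<in> adjoin R t"
  unfolding adjoin_def
  by (rule image_eqI[of _ _ "[:0, 1:]"])
    (auto intro: poly_over_pCons poly_over_0 zero_closed one_closed)

text \<open>Division with remainder remains possible over a ring that is not a field once the dividend
  is multiplied by a power of the leading coefficient of the divisor.\<close>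

lemma pseudo_division:
  assumes "f \<in> poly_over R" "f \<noteq> 0" "g \<in> poly_over R"
  shows "\<exists>k. \<exists>q\<in>poly_over R. \<exists>r\<in>poly_over R.
    smult (lead_coeff f ^ k) g = q * f + r \<and> (r = 0 \<or> degree r < degree f)"
  using assms(3)
proof (induction "degree g" arbitrary: g rule: less_induct)
  case less
  show ?case
  proof (cases "g = 0 \<or> degree g < degree f")
    case True
    then show ?thesis
      using less.prems poly_over_0 by (intro exI[of _ 0] bexI[of _ 0] bexI[of _ g]) auto
  next
    case False
    then have deg: "degree f \<le> degree g" and "g \<noteq> 0"
      by auto
    define a where "a = lead_coeff f"
    define b where "b = lead_coeff g"
    define m where "m = monom b (degree g - degree f)"
    define g' where "g' = smult a g - m * f"
    have ab: "a \<in> R" "b \<in> R" "a \<noteq> 0" "b \<noteq> 0"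
      using assms less.prems \<open>g \<noteq> 0\<close> by (auto simp: a_def b_def poly_over_def)
    have m: "m \<in> poly_over R" "m \<noteq> 0" "degree m = degree g - degree f" "lead_coeff m = b"
      using ab by (auto simp: m_def poly_over_monom degree_monom_eq)
    have g': "g' \<in> poly_over R"
      unfolding g'_def using m ab assms less.prems
      by (intro poly_over_diff poly_over_mult poly_over_smult)
    have "degree (m * f) = degree g"
      using m assms deg by (simp add: degree_mult_eq)
    have "g' = 0 \<or> degree g' < degree g"
    proof (cases "degree g = 0")
      case True
      then obtain c where "g = [:c:]"
        using degree_eq_zeroE by blast
      moreover from this deg obtain d where "f = [:d:]"
        using True degree_eq_zeroE[of f] by auto
      ultimately have "g' = 0"
        by (simp add: g'_def m_def a_def b_def monom_0 mult.commute)
      then show ?thesis ..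
    next
      case False
      have "coeff g' (degree g) = 0"
        using \<open>degree (m * f) = degree g\<close> lead_coeff_mult[of m f] m
        by (simp add: g'_def a_def b_def)
      moreover have "degree g' \<le> degree g"
        unfolding g'_def using \<open>degree (m * f) = degree g\<close>
        by (intro degree_diff_le) (auto simp: degree_smult_le)
      ultimately show ?thesis
        using False leading_coeff_0_iff[of g'] by (metis le_neq_implies_less)
    qed
    moreover have "\<exists>k. \<exists>q\<in>poly_over R. \<exists>r\<in>poly_over R.
      smult (a ^ k) g' = q * f + r \<and> (r = 0 \<or> degree r < degree f)"
      if "g' = 0"
      using that poly_over_0 by (intro exI[of _ 0] bexI[of _ 0]) auto
    ultimately obtain k q r where *: "q \<in> poly_over R" "r \<in> poly_over R"
      "smult (a ^ k) g' = q * f + r" "r = 0 \<or> degree r < degree f"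
      using less.hyps[of g'] g' unfolding a_def by blast
    have "smult (a ^ Suc k) g = (q + smult (a ^ k) m) * f + r"
      using *(3) by (simp add: g'_def smult_diff_right algebra_simps)
    moreover have "q + smult (a ^ k) m \<in> poly_over R"
      using * m ab by (intro poly_over_add poly_over_smult power_closed)
    ultimately show ?thesis
      using * unfolding a_def[symmetric] by blast
  qed
qed

end

locale partial_ring_hom = unital_subring R
  for R :: "'f::field set" +
  fixes \<phi> :: "'f \<Rightarrow> 'k::field"
  assumes hom: "ring_hom_on R \<phi>"
begin

lemma hom_add: "x \<in> R \<Longrightarrow> y \<in> R \<Longrightarrow> \<phi> (x + y) = \<phi> x + \<phi> y"
  and hom_mult: "x \<in> R \<Longrightarrow> y \<in> R \<Longrightarrow> \<phi> (x * y) = \<phi> x * \<phi> y"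
  and hom_1: "\<phi> 1 = 1"
  using hom by (auto simp: ring_hom_on_def)

lemma hom_0: "\<phi> 0 = 0"
  using hom_add[OF zero_closed zero_closed] by (metis add_0 add_cancel_left_right)

lemma hom_sum: "(\<And>i. i \<in> I \<Longrightarrow> f i \<in> R) \<Longrightarrow> \<phi> (sum f I) = (\<Sum>i\<in>I. \<phi> (f i))"
  by (induction I rule: infinite_finite_induct) (auto simp: hom_0 hom_add sum_closed)

lemma hom_power: "x \<in> R \<Longrightarrow> \<phi> (x ^ n) = \<phi> x ^ n"
  by (induction n) (auto simp: hom_1 hom_mult power_closed)

lemma map_poly_hom_add:
  "p \<in> poly_over R \<Longrightarrow> q \<in> poly_over R \<Longrightarrow> map_poly \<phi> (p + q) = map_poly \<phi> p + map_poly \<phi> q"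
  by (rule poly_eqI) (auto simp: coeff_map_poly hom_0 poly_over_def hom_add)

lemma map_poly_hom_mult:
  "p \<in> poly_over R \<Longrightarrow> q \<in> poly_over R \<Longrightarrow> map_poly \<phi> (p * q) = map_poly \<phi> p * map_poly \<phi> q"
  by (rule poly_eqI)
    (auto simp: coeff_map_poly hom_0 poly_over_def coeff_mult hom_sum hom_mult mult_closed)

lemma map_poly_hom_smult:
  "c \<in> R \<Longrightarrow> p \<in> poly_over R \<Longrightarrow> map_poly \<phi> (smult c p) = smult (\<phi> c) (map_poly \<phi> p)"
  by (rule poly_eqI) (auto simp: coeff_map_poly hom_0 poly_over_def hom_mult)

text \<open>The universal property of \<open>R[t]\<close> as a quotient of the polynomial ring: \<open>t\<close> may be sent to \<open>\<xi>\<close>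
  as soon as every relation satisfied by \<open>t\<close> is also satisfied by \<open>\<xi>\<close>.\<close>

lemma extend_to_adjoin:
  assumes relations: "\<And>g. g \<in> poly_over R \<Longrightarrow> poly g t = 0 \<Longrightarrow> poly (map_poly \<phi> g) \<xi> = 0"
  obtains \<psi> where "ring_hom_on (adjoin R t) \<psi>"
    and "\<And>p. p \<in> poly_over R \<Longrightarrow> \<psi> (poly p t) = poly (map_poly \<phi> p) \<xi>"
    and "\<And>x. x \<in> R \<Longrightarrow> \<psi> x = \<phi> x"
proof -
  define rep where "rep x = (SOME p. p \<in> poly_over R \<and> poly p t = x)" for x
  define \<psi> where "\<psi> x = poly (map_poly \<phi> (rep x)) \<xi>" for x
  have \<psi>: "\<psi> (poly p t) = poly (map_poly \<phi> p) \<xi>" if p: "p \<in> poly_over R" for p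
  proof -
    define q where "q = rep (poly p t)"
    have "q \<in> poly_over R \<and> poly q t = poly p t"
      unfolding q_def rep_def by (rule someI[of _ p]) (simp add: p)
    then have q: "q \<in> poly_over R" "poly q t = poly p t"
      by auto
    have "poly (map_poly \<phi> (q - p)) \<xi> = 0"
      using p q by (intro relations) (auto simp: poly_over_diff)
    moreover have "map_poly \<phi> q = map_poly \<phi> (q - p) + map_poly \<phi> p"
      using map_poly_hom_add[of "q - p" p] p q by (simp add: poly_over_diff)
    ultimately show ?thesis
      unfolding \<psi>_def q_def[symmetric] by simp
  qed
  have const: "[:c:] \<in> poly_over R" if "c \<in> R" for c
    using that by (simp add: poly_over_pCons poly_over_0)
  have R: "\<psi> x = \<phi> x" if "x \<in> R" for x
    using \<psi>[OF const[OF that]] by (simp add: map_poly_pCons hom_0)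
  have "ring_hom_on (adjoin R t) \<psi>"
    unfolding ring_hom_on_def adjoin_def
    using \<psi> poly_over_add poly_over_mult R[OF one_closed]
    by (auto simp: map_poly_hom_add map_poly_hom_mult hom_1 simp flip: poly_add poly_mult)
  with \<psi> R show thesis
    using that by blast
qed

end

text \<open>
  If \<open>t\<close> is transcendental over \<open>R\<close>, it can be sent anywhere; \<open>\<psi> s\<close> is then the value at the image of
  \<open>t\<close> of a polynomial that is nonzero unless \<open>\<phi>\<close> kills its leading coefficient, and \<open>K\<close> is infinite.
  Otherwise let \<open>f\<close> be a relation of \<open>t\<close> of least degree. By pseudo-division every relation becomes a
  multiple of \<open>f\<close> after multiplication by a power of the leading coefficient \<open>a\<close> of \<open>f\<close>, so \<open>t\<close> can be
  sent to any root of the image of \<open>f\<close> if \<open>\<phi> a \<noteq> 0\<close>. Moreover \<open>s\<close> divides a nonzero element \<open>c\<close> of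
  \<open>R\<close> inside \<open>R[t]\<close>, so that \<open>\<phi> c \<noteq> 0\<close> forces \<open>\<psi> s \<noteq> 0\<close>; hence \<open>r = a c\<close> works.
\<close>

lemma (in unital_subring) extension_condition:
  assumes s: "s \<in> adjoin R t" "s \<noteq> 0"
  shows "\<exists>r\<in>R. r \<noteq> 0 \<and> (\<forall>\<phi>::'f \<Rightarrow> 'k::alg_closed_field. ring_hom_on R \<phi> \<and> \<phi> r \<noteq> 0 \<longrightarrow>
    (\<exists>\<psi>. ring_hom_on (adjoin R t) \<psi> \<and> (\<forall>x\<in>R. \<psi> x = \<phi> x) \<and> \<psi> s \<noteq> 0))"
proof -
  obtain h where h: "h \<in> poly_over R" "poly h t = s"
    using s by (auto simp: adjoin_def)
  have "h \<noteq> 0"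
    using h s by auto
  show ?thesis
  proof (cases "\<exists>f. f \<in> poly_over R \<and> f \<noteq> 0 \<and> poly f t = 0")
    case False
    show ?thesis
    proof (intro bexI conjI allI impI)
      show "lead_coeff h \<in> R" "lead_coeff h \<noteq> 0"
        using h \<open>h \<noteq> 0\<close> by (auto simp: poly_over_def)
      fix \<phi> :: "'f \<Rightarrow> 'k"
      assume \<phi>: "ring_hom_on R \<phi> \<and> \<phi> (lead_coeff h) \<noteq> 0"
      then interpret partial_ring_hom R \<phi>
        by unfold_locales auto
      have "coeff (map_poly \<phi> h) (degree h) \<noteq> 0"
        using \<phi> by (simp add: coeff_map_poly hom_0)
      then have "map_poly \<phi> h \<noteq> 0"
        by auto
      then obtain \<xi> where \<xi>: "poly (map_poly \<phi> h) \<xi> \<noteq> 0"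
        using exists_nonroot by blast
      have "poly (map_poly \<phi> g) \<xi> = 0" if "g \<in> poly_over R" "poly g t = 0" for g
        using that False by auto
      then obtain \<psi> where "ring_hom_on (adjoin R t) \<psi>"
        "\<And>p. p \<in> poly_over R \<Longrightarrow> \<psi> (poly p t) = poly (map_poly \<phi> p) \<xi>"
        "\<And>x. x \<in> R \<Longrightarrow> \<psi> x = \<phi> x"
        using extend_to_adjoin[of t \<xi>] by metis
      with \<xi> h show "\<exists>\<psi>. ring_hom_on (adjoin R t) \<psi> \<and> (\<forall>x\<in>R. \<psi> x = \<phi> x) \<and> \<psi> s \<noteq> 0"
        by metis
    qed
  next
    case True
    define is_rel where "is_rel f \<longleftrightarrow> f \<in> poly_over R \<and> f \<noteq> 0 \<and> poly f t = 0" for f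
    obtain f where f: "is_rel f" and f_min: "\<And>g. is_rel g \<Longrightarrow> degree f \<le> degree g"
      using True ex_has_least_nat[of is_rel _ degree] unfolding is_rel_def by metis
    note f' = f[unfolded is_rel_def]
    define a where "a = lead_coeff f"
    have a: "a \<in> R" "a \<noteq> 0"
      using f' by (auto simp: a_def poly_over_def)
    have low: "g = 0" if "g \<in> poly_over R" "poly g t = 0" "degree g < degree f" for g
      using f_min[of g] that by (auto simp: is_rel_def)
    have degf: "degree f > 0"
    proof (rule ccontr)
      assume "\<not> degree f > 0"
      then obtain c where "f = [:c:]"
        using degree_eq_zeroE by blast
      with f' show False
        by auto
    qed

    \<comment> \<open>A nonzero multiple of \<open>s\<close> in \<open>R[t]\<close> represented in the lowest possible degree is a constant:
      dividing \<open>f\<close> by it leaves a multiple of \<open>s\<close> of lower degree, hence zero, and the quotient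
      would be a relation of degree lower than \<open>f\<close>.\<close>
    define is_mult where "is_mult w \<longleftrightarrow> w \<in> poly_over R \<and> poly w t \<noteq> 0 \<and>
        (\<exists>u\<in>adjoin R t. poly w t = u * s)" for w
    interpret S: unital_subring "adjoin R t"
      by (rule unital_subring_adjoin)
    have "is_mult h"
      using h s S.one_closed by (auto simp: is_mult_def)
    then obtain w where w: "is_mult w" and w_min: "\<And>g. is_mult g \<Longrightarrow> degree w \<le> degree g"
      using ex_has_least_nat[of is_mult h degree] by metis
    then obtain u where u: "w \<in> poly_over R" "poly w t \<noteq> 0" "u \<in> adjoin R t" "poly w t = u * s"
      by (auto simp: is_mult_def)
    have "w \<noteq> 0"
      using u by auto
    have "degree w < degree f"
    proof -
      obtain k q r where r: "q \<in> poly_over R" "r \<in> poly_over R"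
        "smult (a ^ k) w = q * f + r" "r = 0 \<or> degree r < degree f"
        using pseudo_division[of f w] f' u unfolding a_def by blast
      have "poly r t = a ^ k * poly w t"
        using arg_cong[OF r(3), of "\<lambda>p. poly p t"] f' by simp
      then have "is_mult r"
        using r a u subset_adjoin[of t] power_closed[OF a(1), of k]
        by (auto simp: is_mult_def mult.assoc[symmetric] intro!: bexI[of _ "a ^ k * u"] S.mult_closed)
      then have "degree w \<le> degree r" and "r \<noteq> 0"
        using w_min by (auto simp: is_mult_def)
      with r(4) show ?thesis
        by simp
    qed
    have "degree w = 0"
    proof (rule ccontr)
      assume "degree w \<noteq> 0"
      obtain k q r where r: "q \<in> poly_over R" "r \<in> poly_over R"
        "smult (lead_coeff w ^ k) f = q * w + r" "r = 0 \<or> degree r < degree w"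
        using pseudo_division[of w f] f' u \<open>w \<noteq> 0\<close> by blast
      have eq: "poly r t = - poly q t * poly w t"
        using arg_cong[OF r(3), of "\<lambda>p. poly p t"] f' by (simp add: add_eq_0_iff)
      have "poly q t \<in> adjoin R t"
        using r by (auto simp: adjoin_def)
      then have mult: "- poly q t * u \<in> adjoin R t"
        using S.mult_closed[OF S.diff_closed[OF S.zero_closed] u(3)] by fastforce
      have "\<not> is_mult r"
        using w_min[of r] r(4) by (auto simp: is_mult_def)
      then have "poly r t = 0"
        using eq r mult u unfolding is_mult_def by (metis mult.assoc)
      then have "r = 0"
        using r low[of r] \<open>degree w < degree f\<close> by auto
      then have "q * w = smult (lead_coeff w ^ k) f"
        using r(3) by simp
      moreover from this have "q \<noteq> 0"
        using f' \<open>w \<noteq> 0\<close> by auto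
      ultimately have "degree q + degree w = degree f"
        using \<open>w \<noteq> 0\<close> by (metis degree_mult_eq degree_smult_eq leading_coeff_0_iff power_not_zero)
      moreover have "poly q t = 0"
        using eq u \<open>poly r t = 0\<close> by auto
      ultimately show False
        using low[of q] r \<open>q \<noteq> 0\<close> \<open>degree w \<noteq> 0\<close> by auto
    qed
    then obtain c where "w = [:c:]"
      using degree_eq_zeroE by blast
    then have c: "c \<in> R" "c \<noteq> 0" "c = u * s"
      using u by (auto simp: poly_over_def coeff_pCons split: nat.splits)

    show ?thesis
    proof (intro bexI conjI allI impI)
      show "a * c \<in> R" "a * c \<noteq> 0"
        using a c by (auto simp: mult_closed)
      fix \<phi> :: "'f \<Rightarrow> 'k"
      assume \<phi>: "ring_hom_on R \<phi> \<and> \<phi> (a * c) \<noteq> 0"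
      then interpret partial_ring_hom R \<phi>
        by unfold_locales auto
      have ac: "\<phi> a \<noteq> 0" "\<phi> c \<noteq> 0"
        using \<phi> a c by (auto simp: hom_mult)
      have "coeff (map_poly \<phi> f) (degree f) \<noteq> 0"
        using ac by (simp add: coeff_map_poly hom_0 a_def)
      then have "degree (map_poly \<phi> f) > 0"
        using degf le_degree by fastforce
      then obtain \<xi> where \<xi>: "poly (map_poly \<phi> f) \<xi> = 0"
        using alg_closed_imp_poly_has_root by blast
      have "poly (map_poly \<phi> g) \<xi> = 0" if g: "g \<in> poly_over R" "poly g t = 0" for g
      proof -
        obtain k q r where r: "q \<in> poly_over R" "r \<in> poly_over R"
          "smult (a ^ k) g = q * f + r" "r = 0 \<or> degree r < degree f"
          using pseudo_division[of f g] f' g unfolding a_def by blast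
        have "poly r t = 0"
          using arg_cong[OF r(3), of "\<lambda>p. poly p t"] f' g by simp
        then have "r = 0"
          using low r by auto
        then have "map_poly \<phi> (smult (a ^ k) g) = map_poly \<phi> (q * f)"
          using r(3) by simp
        then have "smult (\<phi> a ^ k) (map_poly \<phi> g) = map_poly \<phi> q * map_poly \<phi> f"
          using f' g a r(1)
          by (simp add: map_poly_hom_smult map_poly_hom_mult hom_power power_closed)
        from arg_cong[OF this, of "\<lambda>p. poly p \<xi>"] show ?thesis
          using \<xi> ac by simp
      qed
      then obtain \<psi> where \<psi>: "ring_hom_on (adjoin R t) \<psi>" "\<And>x. x \<in> R \<Longrightarrow> \<psi> x = \<phi> x"
        using extend_to_adjoin[of t \<xi>] by metis
      then have "\<psi> u * \<psi> s = \<phi> c"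
        using c u s unfolding ring_hom_on_def by metis
      then show "\<exists>\<psi>. ring_hom_on (adjoin R t) \<psi> \<and> (\<forall>x\<in>R. \<psi> x = \<phi> x) \<and> \<psi> s \<noteq> 0"
        using ac \<psi> by (intro exI[of _ \<psi>]) auto
    qed
  qed
qed

context field_embedding
begin

lemma embedding_0: "\<iota> 0 = 0"
  using add[of 0 0] by (metis add_0 add_cancel_left_right)

lemma embedding_diff: "\<iota> (x - y) = \<iota> x - \<iota> y"
  using add[of "x - y" y] by (simp add: eq_diff_eq)

lemma embedding_sum: "\<iota> (sum f I) = (\<Sum>i\<in>I. \<iota> (f i))"
  by (induction I rule: infinite_finite_induct) (auto simp: embedding_0 add)

end

text \<open>This is the weak Nullstellensatz for the \<open>K\<close>-algebra generated by \<open>T\<close>. The induction needs the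
  stronger statement that every nonzero element of the algebra survives under some homomorphism to
  \<open>K\<close>: adjoining a generator is possible only for homomorphisms that avoid the zeros of a given
  element.\<close>

lemma specialization_exists:
  fixes \<iota> :: "'k::alg_closed_field \<Rightarrow> 'f::field"
  assumes "field_embedding \<iota>" "finite T"
  obtains R \<psi> where "unital_subring R" "T \<subseteq> R" "range \<iota> \<subseteq> R"
    "ring_hom_on R \<psi>" "\<And>c. \<psi> (\<iota> c) = c"
proof -
  interpret field_embedding \<iota>
    by fact
  have "\<exists>R. unital_subring R \<and> T \<subseteq> R \<and> range \<iota> \<subseteq> R \<and>
    (\<forall>s\<in>R. s \<noteq> 0 \<longrightarrow> (\<exists>\<psi>. ring_hom_on R \<psi> \<and> (\<forall>c. \<psi> (\<iota> c) = c) \<and> \<psi> s \<noteq> 0))"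
    using assms(2)
  proof (induction T rule: finite_induct)
    case empty
    have "unital_subring (range \<iota>)"
      by unfold_locales (auto simp flip: one embedding_diff mult)
    moreover have "ring_hom_on (range \<iota>) (inv \<iota>)"
      using inv_f_f[OF inj, of 1] inj
      by (auto simp: ring_hom_on_def one simp flip: add mult)
    moreover have "inv \<iota> s \<noteq> 0" if "s \<in> range \<iota>" "s \<noteq> 0" for s
      using that inj embedding_0 by auto
    ultimately show ?case
      using inj by (intro exI[of _ "range \<iota>"]) (metis empty_subsetI inv_f_f order_refl)
  next
    case (insert t T)
    then obtain R where R: "unital_subring R" "T \<subseteq> R" "range \<iota> \<subseteq> R"
      and pts: "\<And>s. s \<in> R \<Longrightarrow> s \<noteq> 0 \<Longrightarrow> \<exists>\<psi>. ring_hom_on R \<psi> \<and> (\<forall>c. \<psi> (\<iota> c) = c) \<and> \<psi> s \<noteq> 0"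
      by blast
    interpret unital_subring R
      by fact
    have "\<exists>\<psi>. ring_hom_on (adjoin R t) \<psi> \<and> (\<forall>c. \<psi> (\<iota> c) = c) \<and> \<psi> s \<noteq> 0"
      if s: "s \<in> adjoin R t" "s \<noteq> 0" for s
    proof -
      obtain r where r: "r \<in> R" "r \<noteq> 0" and ext: "\<And>\<phi>::'f \<Rightarrow> 'k. ring_hom_on R \<phi> \<and> \<phi> r \<noteq> 0 \<Longrightarrow>
        \<exists>\<psi>. ring_hom_on (adjoin R t) \<psi> \<and> (\<forall>x\<in>R. \<psi> x = \<phi> x) \<and> \<psi> s \<noteq> 0"
        using extension_condition[OF s] by metis
      obtain \<phi> where \<phi>: "ring_hom_on R \<phi>" "\<And>c. \<phi> (\<iota> c) = c" "\<phi> r \<noteq> 0"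
        using pts[OF r] by blast
      with ext[of \<phi>] R(3) show ?thesis
        by (metis rangeI subsetD)
    qed
    then show ?case
      using R subset_adjoin[of t] generator_in_adjoin[of t] unital_subring_adjoin[of t]
      by (intro exI[of _ "adjoin R t"]) auto
  qed
  then show thesis
    using that unital_subring.one_closed by (metis zero_neq_one)
qed

section \<open>Algebras given by structure constants\<close>

text \<open>An element of \<open>F\<^sup>I\<close> is encoded as a function that vanishes outside \<open>I\<close>, so that equal tuples are
  equal functions.\<close>

definition structure_algebra ::
  "'i set \<Rightarrow> ('i \<Rightarrow> 'i \<Rightarrow> 'i \<Rightarrow> 'f::field) \<Rightarrow> ('f, 'i \<Rightarrow> 'f) algebra_on" where
  "structure_algebra I c =
     \<lparr>elems = {x. \<forall>i. i \<notin> I \<longrightarrow> x i = 0},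
      alg_add = (\<lambda>x y i. x i + y i),
      alg_scale = (\<lambda>h x i. h * x i),
      alg_prod = (\<lambda>x y k. if k \<in> I then \<Sum>i\<in>I. \<Sum>j\<in>I. x i * y j * c i j k else 0)\<rparr>"

text \<open>The rows of \<open>P\<close> are the coordinates of the images of basis vectors. The inverse \<open>Q\<close> is part of
  the data so that the conditions are polynomial equations in the entries of \<open>P\<close> and \<open>Q\<close>.\<close>

definition isomorphism_matrices ::
  "'i set \<Rightarrow> 'j set \<Rightarrow> ('i \<Rightarrow> 'i \<Rightarrow> 'i \<Rightarrow> 'f::field) \<Rightarrow> ('j \<Rightarrow> 'j \<Rightarrow> 'j \<Rightarrow> 'f) \<Rightarrow>
    ('i \<Rightarrow> 'j \<Rightarrow> 'f) \<Rightarrow> ('j \<Rightarrow> 'i \<Rightarrow> 'f) \<Rightarrow> bool" where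
  "isomorphism_matrices I J c d P Q \<longleftrightarrow>
     (\<forall>i\<in>I. \<forall>i'\<in>I. (\<Sum>j\<in>J. P i j * Q j i') = (if i = i' then 1 else 0)) \<and>
     (\<forall>j\<in>J. \<forall>j'\<in>J. (\<Sum>i\<in>I. Q j i * P i j') = (if j = j' then 1 else 0)) \<and>
     (\<forall>i\<in>I. \<forall>i'\<in>I. \<forall>j\<in>J.
        (\<Sum>k\<in>I. c i i' k * P k j) = (\<Sum>l\<in>J. \<Sum>m\<in>J. P i l * P i' m * d l m j))"

lemma isomorphism_matrices_embedding:
  assumes "field_embedding \<iota>" "isomorphism_matrices I J c d P Q"
  shows "isomorphism_matrices I J (\<lambda>i j k. \<iota> (c i j k)) (\<lambda>i j k. \<iota> (d i j k))
    (\<lambda>i j. \<iota> (P i j)) (\<lambda>j i. \<iota> (Q j i))"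
proof -
  interpret field_embedding \<iota>
    by fact
  show ?thesis
    using assms(2) unfolding isomorphism_matrices_def
    by (simp add: one embedding_0 flip: mult embedding_sum)
qed

text \<open>A homomorphism to \<open>K\<close> defined on a ring that contains all entries, and fixing \<open>K\<close>, preserves
  the equations.\<close>

lemma isomorphism_matrices_specialize:
  fixes \<iota> :: "'k::alg_closed_field \<Rightarrow> 'f::field"
  assumes "field_embedding \<iota>" "finite I" "finite J"
    and PQ: "isomorphism_matrices I J (\<lambda>i j k. \<iota> (c i j k)) (\<lambda>i j k. \<iota> (d i j k)) P Q"
  shows "\<exists>P' Q'. isomorphism_matrices I J c d P' Q'"
proof -
  define T where "T = case_prod P ` (I \<times> J) \<union> case_prod Q ` (J \<times> I)"
  have "finite T"
    using assms by (simp add: T_def)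
  then obtain R \<psi> where R: "unital_subring R" "T \<subseteq> R" "range \<iota> \<subseteq> R" "ring_hom_on R \<psi>"
    and \<psi>: "\<And>c. \<psi> (\<iota> c) = c"
    using specialization_exists[OF assms(1), of T] by metis
  interpret partial_ring_hom R \<psi>
    using R by unfold_locales (auto simp: unital_subring_def)
  have [simp]: "P i j \<in> R" "Q j i \<in> R" if "i \<in> I" "j \<in> J" for i j
    using R(2) that by (auto simp: T_def)
  have [simp]: "\<iota> x \<in> R" for x
    using R(3) by auto
  have *: "\<psi> (if b then 1 else 0) = (if b then 1 else 0)" for b
    by (simp add: hom_0 hom_1)
  have "(\<Sum>j\<in>J. \<psi> (P i j) * \<psi> (Q j i')) = (if i = i' then 1 else 0)" if "i \<in> I" "i' \<in> I" for i i'
  proof -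
    have "(\<Sum>j\<in>J. \<psi> (P i j) * \<psi> (Q j i')) = \<psi> (\<Sum>j\<in>J. P i j * Q j i')"
      using that by (simp add: hom_sum hom_mult mult_closed)
    then show ?thesis
      using PQ that by (simp add: isomorphism_matrices_def *)
  qed
  moreover have "(\<Sum>i\<in>I. \<psi> (Q j i) * \<psi> (P i j')) = (if j = j' then 1 else 0)"
    if "j \<in> J" "j' \<in> J" for j j'
  proof -
    have "(\<Sum>i\<in>I. \<psi> (Q j i) * \<psi> (P i j')) = \<psi> (\<Sum>i\<in>I. Q j i * P i j')"
      using that by (simp add: hom_sum hom_mult mult_closed)
    then show ?thesis
      using PQ that by (simp add: isomorphism_matrices_def *)
  qed
  moreover have "(\<Sum>k\<in>I. c i i' k * \<psi> (P k j)) = (\<Sum>l\<in>J. \<Sum>m\<in>J. \<psi> (P i l) * \<psi> (P i' m) * d l m j)"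
    if "i \<in> I" "i' \<in> I" "j \<in> J" for i i' j
  proof -
    have "(\<Sum>k\<in>I. c i i' k * \<psi> (P k j)) = \<psi> (\<Sum>k\<in>I. \<iota> (c i i' k) * P k j)"
      using that by (simp add: hom_sum hom_mult mult_closed \<psi>)
    also have "(\<Sum>k\<in>I. \<iota> (c i i' k) * P k j) = (\<Sum>l\<in>J. \<Sum>m\<in>J. P i l * P i' m * \<iota> (d l m j))"
      using PQ that by (simp add: isomorphism_matrices_def)
    also have "\<psi> \<dots> = (\<Sum>l\<in>J. \<Sum>m\<in>J. \<psi> (P i l) * \<psi> (P i' m) * d l m j)"
      using that by (simp add: hom_sum hom_mult mult_closed sum_closed \<psi>)
    finally show ?thesis .
  qed
  ultimately show ?thesis
    unfolding isomorphism_matrices_def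
    by (intro exI[of _ "\<lambda>i j. \<psi> (P i j)"] exI[of _ "\<lambda>j i. \<psi> (Q j i)"]) simp
qed

text \<open>An isomorphism has to respect the operations on the set of elements only; passing to its inverse
  uses that the operations of the source stay in that set.\<close>

definition algebra_closed :: "('f, 't) algebra_on \<Rightarrow> bool" where
  "algebra_closed A \<longleftrightarrow>
     (\<forall>x\<in>elems A. \<forall>y\<in>elems A. alg_add A x y \<in> elems A \<and> alg_prod A x y \<in> elems A) \<and>
     (\<forall>h. \<forall>x\<in>elems A. alg_scale A h x \<in> elems A)"

lemma algebra_isomorphic_sym:
  assumes "algebra_closed A" "algebra_isomorphic A B"
  shows "algebra_isomorphic B A"
proof -
  obtain \<phi> where \<phi>: "bij_betw \<phi> (elems A) (elems B)"
    and hom: "\<And>x y. x \<in> elems A \<Longrightarrow> y \<in> elems A \<Longrightarrow> \<phi> (alg_add A x y) = alg_add B (\<phi> x) (\<phi> y)"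
      "\<And>h x. x \<in> elems A \<Longrightarrow> \<phi> (alg_scale A h x) = alg_scale B h (\<phi> x)"
      "\<And>x y. x \<in> elems A \<Longrightarrow> y \<in> elems A \<Longrightarrow> \<phi> (alg_prod A x y) = alg_prod B (\<phi> x) (\<phi> y)"
    using assms(2) unfolding algebra_isomorphic_def by blast
  define \<psi> where "\<psi> = inv_into (elems A) \<phi>"
  have \<psi>: "\<psi> y \<in> elems A" "\<phi> (\<psi> y) = y" if "y \<in> elems B" for y
    using that \<phi> unfolding \<psi>_def
    by (metis bij_betw_imp_surj_on inv_into_into, metis bij_betw_inv_into_right)
  have \<psi>\<phi>: "\<psi> (\<phi> x) = x" if "x \<in> elems A" for x
    using that \<phi> unfolding \<psi>_def by (metis bij_betw_inv_into_left)
  have "bij_betw \<psi> (elems B) (elems A)"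
    unfolding \<psi>_def using \<phi> by (rule bij_betw_inv_into)
  moreover have "\<psi> (alg_add B x y) = alg_add A (\<psi> x) (\<psi> y)"
    "\<psi> (alg_prod B x y) = alg_prod A (\<psi> x) (\<psi> y)" if xy: "x \<in> elems B" "y \<in> elems B" for x y
  proof -
    have "alg_add A (\<psi> x) (\<psi> y) \<in> elems A" "alg_prod A (\<psi> x) (\<psi> y) \<in> elems A"
      using assms(1) \<psi>(1)[OF xy(1)] \<psi>(1)[OF xy(2)] by (auto simp: algebra_closed_def)
    from this[THEN \<psi>\<phi>] show "\<psi> (alg_add B x y) = alg_add A (\<psi> x) (\<psi> y)"
        "\<psi> (alg_prod B x y) = alg_prod A (\<psi> x) (\<psi> y)"
      by (simp_all only: hom \<psi> xy)
  qed
  moreover have "\<psi> (alg_scale B h x) = alg_scale A h (\<psi> x)" if x: "x \<in> elems B" for h x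
  proof -
    have "alg_scale A h (\<psi> x) \<in> elems A"
      using assms(1) \<psi>(1)[OF x] by (auto simp: algebra_closed_def)
    from this[THEN \<psi>\<phi>] show ?thesis
      by (simp only: hom \<psi> x)
  qed
  ultimately show ?thesis
    unfolding algebra_isomorphic_def by blast
qed

lemma algebra_isomorphic_trans:
  assumes "algebra_isomorphic A B" "algebra_isomorphic B C"
  shows "algebra_isomorphic A C"
proof -
  obtain \<phi> where \<phi>: "bij_betw \<phi> (elems A) (elems B)"
      "\<And>x y. x \<in> elems A \<Longrightarrow> y \<in> elems A \<Longrightarrow> \<phi> (alg_add A x y) = alg_add B (\<phi> x) (\<phi> y)"
      "\<And>h x. x \<in> elems A \<Longrightarrow> \<phi> (alg_scale A h x) = alg_scale B h (\<phi> x)"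
      "\<And>x y. x \<in> elems A \<Longrightarrow> y \<in> elems A \<Longrightarrow> \<phi> (alg_prod A x y) = alg_prod B (\<phi> x) (\<phi> y)"
    using assms(1) unfolding algebra_isomorphic_def by blast
  obtain \<psi> where \<psi>: "bij_betw \<psi> (elems B) (elems C)"
      "\<And>x y. x \<in> elems B \<Longrightarrow> y \<in> elems B \<Longrightarrow> \<psi> (alg_add B x y) = alg_add C (\<psi> x) (\<psi> y)"
      "\<And>h x. x \<in> elems B \<Longrightarrow> \<psi> (alg_scale B h x) = alg_scale C h (\<psi> x)"
      "\<And>x y. x \<in> elems B \<Longrightarrow> y \<in> elems B \<Longrightarrow> \<psi> (alg_prod B x y) = alg_prod C (\<psi> x) (\<psi> y)"
    using assms(2) unfolding algebra_isomorphic_def by blast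
  show ?thesis
    unfolding algebra_isomorphic_def
    using bij_betw_trans[OF \<phi>(1) \<psi>(1)] bij_betw_apply[OF \<phi>(1)]
    by (intro exI[of _ "\<psi> \<circ> \<phi>"]) (simp add: \<phi>(2-4) \<psi>(2-4))
qed

lemma linear_map_matrix:
  fixes \<phi> :: "('i \<Rightarrow> 'f::field) \<Rightarrow> 'j \<Rightarrow> 'f"
  assumes "finite I"
    and add: "\<And>x y. x \<in> elems (structure_algebra I c) \<Longrightarrow> y \<in> elems (structure_algebra I c) \<Longrightarrow>
      \<phi> (\<lambda>i. x i + y i) = (\<lambda>j. \<phi> x j + \<phi> y j)"
    and scale: "\<And>h x. x \<in> elems (structure_algebra I c) \<Longrightarrow> \<phi> (\<lambda>i. h * x i) = (\<lambda>j. h * \<phi> x j)"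
    and x: "x \<in> elems (structure_algebra I c)"
  shows "\<phi> x j = (\<Sum>i\<in>I. x i * \<phi> (\<lambda>k. if k = i then 1 else 0) j)"
proof -
  have E: "elems (structure_algebra I c) = {x. \<forall>i. i \<notin> I \<longrightarrow> x i = 0}"
    by (simp add: structure_algebra_def)
  have "\<phi> (\<lambda>i. if i \<in> S then x i else 0) j = (\<Sum>i\<in>S. x i * \<phi> (\<lambda>k. if k = i then 1 else 0) j)"
    if "S \<subseteq> I" for S
    using finite_subset[OF that assms(1)] that
  proof (induction S rule: finite_induct)
    case empty
    then show ?case
      using fun_cong[OF scale[of "\<lambda>_. 0" 0], of j] by (simp add: E)
  next
    case (insert s S)
    let ?e = "\<lambda>i. if i = s then 1 else 0" and ?y = "\<lambda>i. if i \<in> S then x i else 0"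
    have el: "(\<lambda>i. x s * ?e i) \<in> elems (structure_algebra I c)"
      "?e \<in> elems (structure_algebra I c)" "?y \<in> elems (structure_algebra I c)"
      using insert.prems x by (auto simp: E)
    have "(\<lambda>i. if i \<in> insert s S then x i else 0) = (\<lambda>i. x s * ?e i + ?y i)"
      using insert.hyps by (auto simp: fun_eq_iff)
    then have "\<phi> (\<lambda>i. if i \<in> insert s S then x i else 0) j = x s * \<phi> ?e j + \<phi> ?y j"
      by (simp only: add[OF el(1,3)] scale[OF el(2)])
    also have "\<phi> ?y j = (\<Sum>i\<in>S. x i * \<phi> (\<lambda>k. if k = i then 1 else 0) j)"
      using insert by blast
    finally show ?case
      using insert.hyps by simp
  qed
  moreover have "(\<lambda>i. if i \<in> I then x i else 0) = x"
    using x by (auto simp: E fun_eq_iff)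
  ultimately show ?thesis
    by (metis (no_types, lifting) order_refl)
qed

lemma isomorphism_matrices_imp_isomorphic:
  assumes fin: "finite I" "finite J" and PQ: "isomorphism_matrices I J c d P Q"
  shows "algebra_isomorphic (structure_algebra I c) (structure_algebra J d)"
proof -
  define \<phi> where "\<phi> x = (\<lambda>j. if j \<in> J then \<Sum>i\<in>I. x i * P i j else 0)" for x
  define \<psi> where "\<psi> y = (\<lambda>i. if i \<in> I then \<Sum>j\<in>J. y j * Q j i else 0)" for y
  have inv: "\<And>i i'. i \<in> I \<Longrightarrow> i' \<in> I \<Longrightarrow> (\<Sum>j\<in>J. P i j * Q j i') = (if i = i' then 1 else 0)"
      "\<And>j j'. j \<in> J \<Longrightarrow> j' \<in> J \<Longrightarrow> (\<Sum>i\<in>I. Q j i * P i j') = (if j = j' then 1 else 0)"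
    and mult: "\<And>i i' j. i \<in> I \<Longrightarrow> i' \<in> I \<Longrightarrow> j \<in> J \<Longrightarrow>
        (\<Sum>k\<in>I. c i i' k * P k j) = (\<Sum>l\<in>J. \<Sum>m\<in>J. P i l * P i' m * d l m j)"
    using PQ unfolding isomorphism_matrices_def by blast+
  have \<psi>\<phi>: "\<psi> (\<phi> x) = x" if "\<forall>i. i \<notin> I \<longrightarrow> x i = 0" for x
  proof
    fix k
    show "\<psi> (\<phi> x) k = x k"
    proof (cases "k \<in> I")
      case True
      have "\<psi> (\<phi> x) k = (\<Sum>j\<in>J. \<Sum>i\<in>I. x i * (P i j * Q j k))"
        using True by (simp add: \<psi>_def \<phi>_def sum_distrib_right mult.assoc)
      also have "\<dots> = (\<Sum>i\<in>I. x i * (\<Sum>j\<in>J. P i j * Q j k))"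
        by (subst sum.swap) (simp add: sum_distrib_left)
      also have "\<dots> = (\<Sum>i\<in>I. x i * (if i = k then 1 else 0))"
        by (intro sum.cong refl) (simp add: inv True)
      also have "\<dots> = x k"
        using fin True by (simp add: if_distrib[of "(*) _"] cong: if_cong)
      finally show ?thesis .
    qed (use that in \<open>simp add: \<psi>_def\<close>)
  qed
  have \<phi>\<psi>: "\<phi> (\<psi> y) = y" if "\<forall>j. j \<notin> J \<longrightarrow> y j = 0" for y
  proof
    fix k
    show "\<phi> (\<psi> y) k = y k"
    proof (cases "k \<in> J")
      case True
      have "\<phi> (\<psi> y) k = (\<Sum>i\<in>I. \<Sum>j\<in>J. y j * (Q j i * P i k))"
        using True by (simp add: \<psi>_def \<phi>_def sum_distrib_right mult.assoc)
      also have "\<dots> = (\<Sum>j\<in>J. y j * (\<Sum>i\<in>I. Q j i * P i k))"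
        by (subst sum.swap) (simp add: sum_distrib_left)
      also have "\<dots> = (\<Sum>j\<in>J. y j * (if j = k then 1 else 0))"
        by (intro sum.cong refl) (simp add: inv True)
      also have "\<dots> = y k"
        using fin True by (simp add: if_distrib[of "(*) _"] cong: if_cong)
      finally show ?thesis .
    qed (use that in \<open>simp add: \<phi>_def\<close>)
  qed
  have "bij_betw \<phi> (elems (structure_algebra I c)) (elems (structure_algebra J d))"
    using \<psi>\<phi> \<phi>\<psi>
    by (intro bij_betw_byWitness[of _ \<psi>]) (auto simp: structure_algebra_def \<phi>_def \<psi>_def)
  moreover have "\<phi> (alg_prod (structure_algebra I c) x y) = alg_prod (structure_algebra J d) (\<phi> x) (\<phi> y)"
    for x y
  proof
    fix j
    show "\<phi> (alg_prod (structure_algebra I c) x y) j =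
      alg_prod (structure_algebra J d) (\<phi> x) (\<phi> y) j"
    proof (cases "j \<in> J")
      case True
      have "\<phi> (alg_prod (structure_algebra I c) x y) j =
          (\<Sum>k\<in>I. \<Sum>i\<in>I. \<Sum>i'\<in>I. x i * y i' * (c i i' k * P k j))"
        using True by (simp add: \<phi>_def structure_algebra_def sum_distrib_right mult.assoc)
      also have "\<dots> = (\<Sum>i\<in>I. \<Sum>i'\<in>I. \<Sum>k\<in>I. x i * y i' * (c i i' k * P k j))"
        by (subst sum.swap, rule sum.cong[OF refl], rule sum.swap)
      also have "\<dots> = (\<Sum>i\<in>I. \<Sum>i'\<in>I. x i * y i' * (\<Sum>l\<in>J. \<Sum>m\<in>J. P i l * P i' m * d l m j))"
        by (intro sum.cong refl) (simp add: mult True flip: sum_distrib_left)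
      also have "\<dots> = (\<Sum>i\<in>I. \<Sum>i'\<in>I. \<Sum>l\<in>J. \<Sum>m\<in>J. x i * P i l * (y i' * P i' m) * d l m j)"
        by (simp add: sum_distrib_left mult_ac)
      also have "\<dots> = (\<Sum>i\<in>I. \<Sum>l\<in>J. \<Sum>i'\<in>I. \<Sum>m\<in>J. x i * P i l * (y i' * P i' m) * d l m j)"
        by (rule sum.cong[OF refl], rule sum.swap)
      also have "\<dots> = (\<Sum>l\<in>J. \<Sum>i\<in>I. \<Sum>m\<in>J. \<Sum>i'\<in>I. x i * P i l * (y i' * P i' m) * d l m j)"
        by (subst sum.swap, rule sum.cong[OF refl], rule sum.cong[OF refl], rule sum.swap)
      also have "\<dots> = (\<Sum>l\<in>J. \<Sum>m\<in>J. \<Sum>i\<in>I. \<Sum>i'\<in>I. x i * P i l * (y i' * P i' m) * d l m j)"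
        by (rule sum.cong[OF refl], rule sum.swap)
      also have "\<dots> = alg_prod (structure_algebra J d) (\<phi> x) (\<phi> y) j"
        using True
        by (simp add: structure_algebra_def \<phi>_def sum_product) (simp add: sum_distrib_right)
      finally show ?thesis .
    qed (simp add: \<phi>_def structure_algebra_def)
  qed
  moreover have "\<phi> (alg_add (structure_algebra I c) x y) = alg_add (structure_algebra J d) (\<phi> x) (\<phi> y)"
    "\<phi> (alg_scale (structure_algebra I c) h x) = alg_scale (structure_algebra J d) h (\<phi> x)" for x y h
    by (auto simp: fun_eq_iff \<phi>_def structure_algebra_def sum.distrib distrib_right sum_distrib_left
        mult.assoc)
  ultimately show ?thesis
    unfolding algebra_isomorphic_def by blast
qed

lemma isomorphic_imp_isomorphism_matrices:
  assumes fin: "finite I" "finite J"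
    and iso: "algebra_isomorphic (structure_algebra I c) (structure_algebra J d)"
  shows "\<exists>P Q. isomorphism_matrices I J c d P Q"
proof -
  let ?A = "structure_algebra I c" and ?B = "structure_algebra J d"
  obtain \<phi> where bij: "bij_betw \<phi> (elems ?A) (elems ?B)"
    and \<phi>: "\<And>x y. x \<in> elems ?A \<Longrightarrow> y \<in> elems ?A \<Longrightarrow> \<phi> (alg_add ?A x y) = alg_add ?B (\<phi> x) (\<phi> y)"
      "\<And>h x. x \<in> elems ?A \<Longrightarrow> \<phi> (alg_scale ?A h x) = alg_scale ?B h (\<phi> x)"
      "\<And>x y. x \<in> elems ?A \<Longrightarrow> y \<in> elems ?A \<Longrightarrow> \<phi> (alg_prod ?A x y) = alg_prod ?B (\<phi> x) (\<phi> y)"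
    using iso unfolding algebra_isomorphic_def by blast
  define \<psi> where "\<psi> = inv_into (elems ?A) \<phi>"
  have elA: "x \<in> elems ?A \<longleftrightarrow> (\<forall>i. i \<notin> I \<longrightarrow> x i = 0)" for x
    by (simp add: structure_algebra_def)
  have elB: "x \<in> elems ?B \<longleftrightarrow> (\<forall>i. i \<notin> J \<longrightarrow> x i = 0)" for x
    by (simp add: structure_algebra_def)
  have \<phi>_el: "\<phi> x \<in> elems ?B" if "x \<in> elems ?A" for x
    using bij that by (rule bij_betw_apply)
  have \<psi>: "\<psi> y \<in> elems ?A" "\<phi> (\<psi> y) = y" if "y \<in> elems ?B" for y
    using that bij unfolding \<psi>_def
    by (metis bij_betw_imp_surj_on inv_into_into, metis bij_betw_inv_into_right)
  have \<psi>\<phi>: "\<psi> (\<phi> x) = x" if "x \<in> elems ?A" for x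
    using that bij unfolding \<psi>_def by (metis bij_betw_inv_into_left)
  have \<phi>_add: "\<phi> (\<lambda>i. x i + y i) = (\<lambda>j. \<phi> x j + \<phi> y j)" if "x \<in> elems ?A" "y \<in> elems ?A" for x y
    using \<phi>(1)[OF that] by (simp add: structure_algebra_def)
  have \<phi>_scale: "\<phi> (\<lambda>i. h * x i) = (\<lambda>j. h * \<phi> x j)" if "x \<in> elems ?A" for h x
    using \<phi>(2)[OF that, of h] by (simp add: structure_algebra_def)
  have \<psi>_add: "\<psi> (\<lambda>i. x i + y i) = (\<lambda>j. \<psi> x j + \<psi> y j)" if "x \<in> elems ?B" "y \<in> elems ?B" for x y
  proof -
    have "\<psi> (\<phi> (\<lambda>j. \<psi> x j + \<psi> y j)) = (\<lambda>j. \<psi> x j + \<psi> y j)"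
      using \<psi>(1)[OF that(1)] \<psi>(1)[OF that(2)] by (intro \<psi>\<phi>) (simp add: elA)
    then show ?thesis
      by (simp only: \<phi>_add \<psi> that)
  qed
  have \<psi>_scale: "\<psi> (\<lambda>i. h * x i) = (\<lambda>j. h * \<psi> x j)" if "x \<in> elems ?B" for h x
  proof -
    have "\<psi> (\<phi> (\<lambda>j. h * \<psi> x j)) = (\<lambda>j. h * \<psi> x j)"
      using \<psi>(1)[OF that] by (intro \<psi>\<phi>) (simp add: elA)
    then show ?thesis
      by (simp only: \<phi>_scale \<psi> that)
  qed
  define e :: "'a \<Rightarrow> 'a \<Rightarrow> 'c" where "e i = (\<lambda>k. if k = i then 1 else 0)" for i
  define e' :: "'b \<Rightarrow> 'b \<Rightarrow> 'c" where "e' i = (\<lambda>k. if k = i then 1 else 0)" for i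
  define P where "P i j = \<phi> (e i) j" for i j
  define Q where "Q j i = \<psi> (e' j) i" for i j
  have e: "e i \<in> elems ?A" if "i \<in> I" for i
    using that by (auto simp: elA e_def)
  have e': "e' j \<in> elems ?B" if "j \<in> J" for j
    using that by (auto simp: elB e'_def)
  have \<phi>_mat: "\<phi> x j = (\<Sum>i\<in>I. x i * P i j)" if "x \<in> elems ?A" for x j
    unfolding P_def e_def using fin(1) \<phi>_add \<phi>_scale that by (rule linear_map_matrix)
  have \<psi>_mat: "\<psi> y i = (\<Sum>j\<in>J. y j * Q j i)" if "y \<in> elems ?B" for y i
    unfolding Q_def e'_def using fin(2) \<psi>_add \<psi>_scale that by (rule linear_map_matrix)
  have "(\<Sum>j\<in>J. P i j * Q j i') = (if i = i' then 1 else 0)" if "i \<in> I" for i i'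
  proof -
    have "(\<Sum>j\<in>J. P i j * Q j i') = \<psi> (\<phi> (e i)) i'"
      unfolding P_def by (rule \<psi>_mat[OF \<phi>_el[OF e[OF that]], symmetric])
    also have "\<dots> = e i i'"
      by (simp only: \<psi>\<phi>[OF e[OF that]])
    finally show ?thesis
      by (simp add: e_def)
  qed
  moreover have "(\<Sum>i\<in>I. Q j i * P i j') = (if j = j' then 1 else 0)" if "j \<in> J" for j j'
  proof -
    have "(\<Sum>i\<in>I. Q j i * P i j') = \<phi> (\<psi> (e' j)) j'"
      unfolding Q_def by (rule \<phi>_mat[OF \<psi>(1)[OF e'[OF that]], symmetric])
    also have "\<dots> = e' j j'"
      by (simp only: \<psi>(2)[OF e'[OF that]])
    finally show ?thesis
      by (simp add: e'_def)
  qed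
  moreover have "(\<Sum>k\<in>I. c i i' k * P k j) = (\<Sum>l\<in>J. \<Sum>m\<in>J. P i l * P i' m * d l m j)"
    if "i \<in> I" "i' \<in> I" "j \<in> J" for i i' j
  proof -
    have prod: "alg_prod ?A (e i) (e i') k = (if k \<in> I then c i i' k else 0)" for k
    proof -
      have "(\<Sum>a\<in>I. \<Sum>b\<in>I. e i a * e i' b * c a b k) =
          (\<Sum>a\<in>I. if a = i then \<Sum>b\<in>I. if b = i' then c a b k else 0 else 0)"
        by (intro sum.cong) (auto simp: e_def intro!: sum.cong)
      also have "\<dots> = c i i' k"
        using fin that by simp
      finally show ?thesis
        by (simp add: structure_algebra_def)
    qed
    have "\<phi> (alg_prod ?A (e i) (e i')) j = (\<Sum>k\<in>I. c i i' k * P k j)"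
      by (subst \<phi>_mat) (auto simp: elA prod)
    then show ?thesis
      using \<phi>(3)[OF e[OF that(1)] e[OF that(2)]] that(3)
      by (simp add: structure_algebra_def P_def)
  qed
  ultimately have "isomorphism_matrices I J c d P Q"
    by (simp add: isomorphism_matrices_def)
  then show ?thesis
    by blast
qed

section \<open>Coordinates on an extension of scalars\<close>

text \<open>The group homomorphism that sends each generator \<open>p\<close> to \<open>g p\<close>: the analogue of \<^const>\<open>frag_extend\<close>
  with values in a ring.\<close>

definition additive_extension :: "('p \<Rightarrow> 'f::comm_ring_1) \<Rightarrow> ('p \<Rightarrow>\<^sub>0 int) \<Rightarrow> 'f" where
  "additive_extension g x = (\<Sum>p\<in>Poly_Mapping.keys x. of_int (Poly_Mapping.lookup x p) * g p)"

lemma additive_extension_superset: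
  assumes "finite S" "Poly_Mapping.keys x \<subseteq> S"
  shows "additive_extension g x = (\<Sum>p\<in>S. of_int (Poly_Mapping.lookup x p) * g p)"
  unfolding additive_extension_def using assms
  by (intro sum.mono_neutral_left) (auto simp: in_keys_iff)

lemma additive_extension_of [simp]: "additive_extension g (frag_of p) = g p"
  by (simp add: additive_extension_def keys_frag_of)

lemma additive_extension_0 [simp]: "additive_extension g 0 = 0"
  by (simp add: additive_extension_def)

lemma additive_extension_diff:
  "additive_extension g (x - y) = additive_extension g x - additive_extension g y"
proof -
  let ?S = "Poly_Mapping.keys x \<union> Poly_Mapping.keys y"
  have "Poly_Mapping.keys (x - y) \<subseteq> ?S"
    by (rule keys_diff)
  then show ?thesis
    by (simp add: additive_extension_superset[of ?S] lookup_minus left_diff_distrib sum_subtractf)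
qed

lemma tensor_null_sum:
  "(\<And>i. i \<in> I \<Longrightarrow> f i \<in> tensor_null sV sW) \<Longrightarrow> sum f I \<in> tensor_null sV sW"
  by (induction I rule: infinite_finite_induct) (auto simp: tensor_null.zero tensor_null_add)

lemma tensor_null_zero_left: "frag_of (0, w) \<in> tensor_null sV sW"
  using tensor_null_uminus[OF tensor_null.add_left[of 0 0 w sV sW]] by simp

lemma tensor_null_zero_right: "frag_of (v, 0) \<in> tensor_null sV sW"
  using tensor_null_uminus[OF tensor_null.add_right[of v 0 0 sV sW]] by simp

lemma tensor_null_sum_left:
  "frag_of (sum v I, w) - (\<Sum>i\<in>I. frag_of (v i, w)) \<in> tensor_null sV sW"
proof (induction I rule: infinite_finite_induct)
  case (insert i I)
  have "frag_of (sum v (insert i I), w) - (\<Sum>i\<in>insert i I. frag_of (v i, w)) =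
      (frag_of (v i + sum v I, w) - frag_of (v i, w) - frag_of (sum v I, w)) +
      (frag_of (sum v I, w) - (\<Sum>i\<in>I. frag_of (v i, w)))"
    using insert.hyps by simp
  also have "\<dots> \<in> tensor_null sV sW"
    by (rule tensor_null_add[OF tensor_null.add_left insert.IH])
  finally show ?case .
qed (auto simp: tensor_null_zero_left)

locale algebra_with_basis = nonassoc_algebra scale mul
  for scale :: "'k::field \<Rightarrow> 'a::ab_group_add \<Rightarrow> 'a"
    and mul :: "'a \<Rightarrow> 'a \<Rightarrow> 'a" +
  fixes Basis :: "'a set"
  assumes finite_Basis: "finite Basis"
    and independent_Basis: "independent Basis"
    and span_Basis: "span Basis = UNIV"
begin

abbreviation coef :: "'a \<Rightarrow> 'a \<Rightarrow> 'k" where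
  "coef \<equiv> representation Basis"

definition structure_constants :: "'a \<Rightarrow> 'a \<Rightarrow> 'a \<Rightarrow> 'k" where
  "structure_constants a b = coef (mul a b)"

lemma coef_expansion: "(\<Sum>b\<in>Basis. scale (coef a b) b) = a"
  using sum_representation_eq[OF independent_Basis, of a Basis] finite_Basis span_Basis by simp

lemma coef_add: "coef (a + a') b = coef a b + coef a' b"
  by (simp add: representation_add independent_Basis span_Basis)

lemma coef_scale: "coef (scale c a) b = c * coef a b"
  by (simp add: representation_scale independent_Basis span_Basis)

lemma coef_sum: "coef (sum v I) b = (\<Sum>i\<in>I. coef (v i) b)"
  by (simp add: representation_sum independent_Basis span_Basis)

lemma mul_sum_left: "mul (sum v I) y = (\<Sum>i\<in>I. mul (v i) y)"
proof -
  have "mul 0 y = 0"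
    using mul_add_left[of 0 0 y] by simp
  then show ?thesis
    by (induction I rule: infinite_finite_induct) (auto simp: mul_add_left)
qed

lemma mul_sum_right: "mul x (sum v I) = (\<Sum>i\<in>I. mul x (v i))"
proof -
  have "mul x 0 = 0"
    using mul_add_right[of x 0 0] by simp
  then show ?thesis
    by (induction I rule: infinite_finite_induct) (auto simp: mul_add_right)
qed

lemma coef_mul:
  "coef (mul a a') b =
     (\<Sum>i\<in>Basis. \<Sum>j\<in>Basis. coef a i * coef a' j * structure_constants i j b)"
proof -
  have "mul a a' = (\<Sum>i\<in>Basis. \<Sum>j\<in>Basis. scale (coef a i * coef a' j) (mul i j))"
    by (subst (1) coef_expansion[of a, symmetric], subst (1) coef_expansion[of a', symmetric])
      (simp add: mul_sum_left mul_sum_right mul_scale_left mul_scale_right scale_sum_right,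
        subst sum.swap, simp add: mult.commute)
  then show ?thesis
    by (simp add: coef_sum coef_scale structure_constants_def)
qed

end

locale scalar_extension_with_basis = algebra_with_basis scale mul Basis + embedding: field_embedding \<iota>
  for scale :: "'k::field \<Rightarrow> 'a::ab_group_add \<Rightarrow> 'a"
    and mul :: "'a \<Rightarrow> 'a \<Rightarrow> 'a"
    and Basis :: "'a set"
    and \<iota> :: "'k \<Rightarrow> 'f::field"
begin

abbreviation null :: "('a \<times> 'f \<Rightarrow>\<^sub>0 int) set" where
  "null \<equiv> tensor_null scale (\<lambda>c f. \<iota> c * f)"

abbreviation rel :: "('a \<times> 'f \<Rightarrow>\<^sub>0 int) rel" where
  "rel \<equiv> tensor_rel scale (\<lambda>c f. \<iota> c * f)"

abbreviation extension :: "('f, ('a \<times> 'f \<Rightarrow>\<^sub>0 int) set) algebra_on" where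
  "extension \<equiv> scalar_extension \<iota> scale mul"

text \<open>The coordinates of a formal sum with respect to the basis vectors \<open>b \<otimes> 1\<close> of \<open>A\<^sub>F\<close>.\<close>

definition coords :: "('a \<times> 'f \<Rightarrow>\<^sub>0 int) \<Rightarrow> 'a \<Rightarrow> 'f" where
  "coords x b = additive_extension (\<lambda>(a, f). \<iota> (coef a b) * f) x"

lemma coords_outside: "b \<notin> Basis \<Longrightarrow> coords x b = 0"
  using representation_ne_zero[of Basis _ b]
  by (force simp: coords_def additive_extension_def embedding.embedding_0 split_def
      intro!: sum.neutral)

lemma coords_of [simp]: "coords (frag_of (a, f)) b = \<iota> (coef a b) * f"
  and coords_0 [simp]: "coords 0 b = 0"
  and coords_diff: "coords (x - y) b = coords x b - coords y b"
  by (simp_all add: coords_def additive_extension_diff)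

lemma coords_add: "coords (x + y) b = coords x b + coords y b"
  using coords_diff[of "x + y" y b] by simp

lemma coords_sum: "coords (sum x I) b = (\<Sum>i\<in>I. coords (x i) b)"
  by (induction I rule: infinite_finite_induct) (auto simp: coords_add)

lemma coords_null: "x \<in> null \<Longrightarrow> coords x b = 0"
proof (induction rule: tensor_null.induct)
  case (balanced c v w)
  then show ?case
    by (simp add: coords_diff coef_scale embedding.mult)
qed (simp_all add: coords_diff coef_add embedding.add distrib_left distrib_right)

text \<open>Modulo the relations of the tensor product, every formal sum equals the combination of the
  \<open>b \<otimes> 1\<close> given by its coordinates. Hence the coordinates determine its class.\<close>

lemma basis_expansion: "x - (\<Sum>b\<in>Basis. frag_of (b, coords x b)) \<in> null"
  using subset_UNIV[of "Poly_Mapping.keys x"]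
proof (induction x rule: frag_induction)
  case zero
  show ?case
    using tensor_null.diff[OF tensor_null.zero tensor_null_sum[of Basis "\<lambda>b. frag_of (b, 0)"]]
    by (simp add: tensor_null_zero_right)
next
  case (one p)
  obtain a f where p: "p = (a, f)"
    by force
  have "frag_of p - (\<Sum>b\<in>Basis. frag_of (b, coords (frag_of p) b)) =
      (frag_of (\<Sum>b\<in>Basis. scale (coef a b) b, f) - (\<Sum>b\<in>Basis. frag_of (scale (coef a b) b, f))) +
      (\<Sum>b\<in>Basis. frag_of (scale (coef a b) b, f) - frag_of (b, \<iota> (coef a b) * f))"
    by (simp add: p coef_expansion sum_subtractf)
  also have "\<dots> \<in> null"
    by (intro tensor_null_add tensor_null_sum_left tensor_null_sum tensor_null.balanced)
  finally show ?case .
next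
  case (diff x y)
  let ?s = "\<lambda>x. \<Sum>b\<in>Basis. frag_of (b, coords x b)"
  have "x - y - ?s (x - y) = (x - ?s x) - (y - ?s y) + (\<Sum>b\<in>Basis.
      frag_of (b, coords (x - y) b + coords y b) - frag_of (b, coords (x - y) b)
      - frag_of (b, coords y b))"
    by (simp add: sum_subtractf coords_diff)
  also have "\<dots> \<in> null"
    by (rule tensor_null_add[OF tensor_null.diff[OF diff] tensor_null_sum[OF tensor_null.add_right]])
  finally show ?case .
qed

lemma coords_eq_0_imp_null: "(\<And>b. coords x b = 0) \<Longrightarrow> x \<in> null"
  using tensor_null_add[OF basis_expansion[of x] tensor_null_sum[of Basis "\<lambda>b. frag_of (b, 0)"]]
  by (simp add: tensor_null_zero_right)

lemma rel_iff_coords: "(x, y) \<in> rel \<longleftrightarrow> coords x = coords y"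
proof
  assume "(x, y) \<in> rel"
  then show "coords x = coords y"
    using coords_null[of "x - y"] by (auto simp: tensor_rel_def coords_diff)
next
  assume "coords x = coords y"
  then show "(x, y) \<in> rel"
    using coords_eq_0_imp_null[of "x - y"] by (simp add: tensor_rel_def coords_diff)
qed

lemma coords_scale: "coords (formal_scale h x) b = h * coords x b"
  using subset_UNIV[of "Poly_Mapping.keys x"]
  by (induction x rule: frag_induction)
    (auto simp: formal_scale_def frag_extend_diff coords_diff algebra_simps)

lemma coords_prod:
  "coords (formal_prod mul x y) b =
     (\<Sum>i\<in>Basis. \<Sum>j\<in>Basis. coords x i * coords y j * \<iota> (structure_constants i j b))"
proof -
  have of: "coords (frag_extend (\<lambda>(a', g). frag_of (mul a a', f * g)) y) b =
      (\<Sum>i\<in>Basis. \<Sum>j\<in>Basis. \<iota> (coef a i) * f * coords y j * \<iota> (structure_constants i j b))" for a f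
    using subset_UNIV[of "Poly_Mapping.keys y"]
  proof (induction y rule: frag_induction)
    case (one p)
    then show ?case
      by (cases p) (simp add: coef_mul embedding.embedding_sum embedding.mult sum_distrib_left
          sum_distrib_right mult_ac)
  qed (simp_all add: frag_extend_diff coords_diff algebra_simps sum_subtractf)
  show ?thesis
    using subset_UNIV[of "Poly_Mapping.keys x"]
  proof (induction x rule: frag_induction)
    case (one p)
    then show ?case
      by (cases p) (simp add: formal_prod_def of)
  qed (simp_all add: formal_prod_def frag_extend_diff coords_diff algebra_simps sum_subtractf)
qed

lemma extension_ops:
  "alg_add extension (rel `` {x}) (rel `` {y}) = rel `` {x + y}"
  "alg_scale extension h (rel `` {x}) = rel `` {formal_scale h x}"
  "alg_prod extension (rel `` {x}) (rel `` {y}) = rel `` {formal_prod mul x y}"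
  and elems_extension: "elems extension = UNIV // rel"
  unfolding scalar_extension_def Let_def
  by (simp_all add: UN_equiv_class2[OF equiv_tensor_rel equiv_tensor_rel tensor_add_respects]
      UN_equiv_class[OF equiv_tensor_rel tensor_scale_respects]
      UN_equiv_class2[OF equiv_tensor_rel equiv_tensor_rel tensor_prod_respects])

lemma class_in_elems: "rel `` {x} \<in> elems extension"
  unfolding elems_extension by (rule quotientI) simp

lemma elems_extensionE:
  assumes "X \<in> elems extension"
  obtains x where "X = rel `` {x}"
  using assms unfolding elems_extension by (rule quotientE)

lemma algebra_closed_extension: "algebra_closed extension"
  unfolding algebra_closed_def
  by (auto elim!: elems_extensionE simp: extension_ops class_in_elems)

text \<open>Coordinates separate the classes (\<open>rel_iff_coords\<close>), and every tuple on the basis is attained.\<close>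

lemma extension_isomorphic_structure_algebra:
  "algebra_isomorphic extension
     (structure_algebra Basis (\<lambda>i j k. \<iota> (structure_constants i j k)))" (is "algebra_isomorphic _ ?S")
proof -
  define \<phi> where "\<phi> X = coords (SOME x. x \<in> X)" for X
  have \<phi>: "\<phi> (rel `` {x}) = coords x" for x
  proof -
    have "(SOME y. y \<in> rel `` {x}) \<in> rel `` {x}"
      by (rule someI[of _ x]) (simp add: rel_iff_coords)
    then have "(x, SOME y. y \<in> rel `` {x}) \<in> rel"
      by blast
    then have "coords x = \<phi> (rel `` {x})"
      unfolding \<phi>_def by (rule iffD1[OF rel_iff_coords])
    then show ?thesis
      by (rule sym)
  qed
  have coords_el: "coords x \<in> elems ?S" for x
    by (simp add: structure_algebra_def coords_outside)
  have "bij_betw \<phi> (elems extension) (elems ?S)"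
  proof (rule bij_betwI')
    fix X Y
    assume XY: "X \<in> elems extension" "Y \<in> elems extension"
    obtain x where "X = rel `` {x}"
      using XY(1) by (rule elems_extensionE)
    moreover obtain y where "Y = rel `` {y}"
      using XY(2) by (rule elems_extensionE)
    ultimately show "\<phi> X = \<phi> Y \<longleftrightarrow> X = Y"
      by (simp add: \<phi> eq_equiv_class_iff[OF equiv_tensor_rel] rel_iff_coords)
  next
    fix X
    assume "X \<in> elems extension"
    then show "\<phi> X \<in> elems ?S"
      using coords_el by (auto elim!: elems_extensionE simp: \<phi>)
  next
    fix y
    assume y: "y \<in> elems ?S"
    have "coords (\<Sum>b\<in>Basis. frag_of (b, y b)) k = y k" for k
    proof -
      have "coords (\<Sum>b\<in>Basis. frag_of (b, y b)) k = (\<Sum>b\<in>Basis. if b = k then y b else 0)"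
        unfolding coords_sum
        by (intro sum.cong refl) (auto simp: representation_basis[OF independent_Basis]
            embedding.one embedding.embedding_0)
      also have "\<dots> = y k"
        using y finite_Basis by (simp add: structure_algebra_def)
      finally show ?thesis .
    qed
    then have "y = \<phi> (rel `` {\<Sum>b\<in>Basis. frag_of (b, y b)})"
      unfolding \<phi> by (intro ext) simp
    then show "\<exists>X\<in>elems extension. y = \<phi> X"
      using class_in_elems by (rule bexI)
  qed
  moreover have "\<phi> (alg_add extension X Y) = alg_add ?S (\<phi> X) (\<phi> Y)"
    "\<phi> (alg_prod extension X Y) = alg_prod ?S (\<phi> X) (\<phi> Y)"
    if XY: "X \<in> elems extension" "Y \<in> elems extension" for X Y
  proof -
    obtain x where x: "X = rel `` {x}"
      using XY(1) by (rule elems_extensionE)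
    obtain y where y: "Y = rel `` {y}"
      using XY(2) by (rule elems_extensionE)
    show "\<phi> (alg_add extension X Y) = alg_add ?S (\<phi> X) (\<phi> Y)"
      unfolding x y extension_ops \<phi> by (simp add: structure_algebra_def coords_add fun_eq_iff)
    show "\<phi> (alg_prod extension X Y) = alg_prod ?S (\<phi> X) (\<phi> Y)"
      unfolding x y extension_ops \<phi>
      using coords_outside[of _ "formal_prod mul x y"]
      by (auto simp: structure_algebra_def coords_prod fun_eq_iff)
  qed
  moreover have "\<phi> (alg_scale extension h X) = alg_scale ?S h (\<phi> X)"
    if X: "X \<in> elems extension" for h X
  proof -
    obtain x where x: "X = rel `` {x}"
      using X by (rule elems_extensionE)
    show ?thesis
      unfolding x extension_ops \<phi> by (simp add: structure_algebra_def coords_scale fun_eq_iff)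
  qed
  ultimately show ?thesis
    unfolding algebra_isomorphic_def by blast
qed

end

text \<open>The right-hand side speaks of matrices over \<open>K\<close> only: they exist as soon as matrices over \<open>F\<close> do,
  by specialisation, and conversely they can be read over \<open>F\<close>.\<close>

theorem scalar_extensions_isomorphic_iff:
  fixes \<iota> :: "'k::alg_closed_field \<Rightarrow> 'f::field"
  assumes "field_embedding \<iota>"
    and "algebra_with_basis scale\<^sub>A mul\<^sub>A I" "algebra_with_basis scale\<^sub>B mul\<^sub>B J"
  shows "algebra_isomorphic (scalar_extension \<iota> scale\<^sub>A mul\<^sub>A) (scalar_extension \<iota> scale\<^sub>B mul\<^sub>B) \<longleftrightarrow>
    (\<exists>P Q. isomorphism_matrices I J (algebra_with_basis.structure_constants scale\<^sub>A mul\<^sub>A I)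
      (algebra_with_basis.structure_constants scale\<^sub>B mul\<^sub>B J) P Q)"
proof -
  interpret A: algebra_with_basis scale\<^sub>A mul\<^sub>A I
    by fact
  interpret B: algebra_with_basis scale\<^sub>B mul\<^sub>B J
    by fact
  interpret field_embedding \<iota>
    by fact
  interpret AF: scalar_extension_with_basis scale\<^sub>A mul\<^sub>A I \<iota> ..
  interpret BF: scalar_extension_with_basis scale\<^sub>B mul\<^sub>B J \<iota> ..
  let ?SA = "structure_algebra I (\<lambda>i j k. \<iota> (A.structure_constants i j k))"
  let ?SB = "structure_algebra J (\<lambda>i j k. \<iota> (B.structure_constants i j k))"
  have "algebra_isomorphic AF.extension BF.extension \<longleftrightarrow> algebra_isomorphic ?SA ?SB"
  proof
    assume "algebra_isomorphic AF.extension BF.extension"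
    then have "algebra_isomorphic AF.extension ?SB"
      using BF.extension_isomorphic_structure_algebra by (rule algebra_isomorphic_trans)
    with algebra_isomorphic_sym[OF AF.algebra_closed_extension
        AF.extension_isomorphic_structure_algebra]
    show "algebra_isomorphic ?SA ?SB"
      by (rule algebra_isomorphic_trans)
  next
    assume "algebra_isomorphic ?SA ?SB"
    with AF.extension_isomorphic_structure_algebra have "algebra_isomorphic AF.extension ?SB"
      by (rule algebra_isomorphic_trans)
    then show "algebra_isomorphic AF.extension BF.extension"
      using algebra_isomorphic_sym[OF BF.algebra_closed_extension
          BF.extension_isomorphic_structure_algebra]
      by (rule algebra_isomorphic_trans)
  qed
  also have "\<dots> \<longleftrightarrow> (\<exists>P Q. isomorphism_matrices I J (\<lambda>i j k. \<iota> (A.structure_constants i j k))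
      (\<lambda>i j k. \<iota> (B.structure_constants i j k)) P Q)"
    using isomorphic_imp_isomorphism_matrices[OF A.finite_Basis B.finite_Basis]
      isomorphism_matrices_imp_isomorphic[OF A.finite_Basis B.finite_Basis] by blast
  also have "\<dots> \<longleftrightarrow> (\<exists>P Q. isomorphism_matrices I J A.structure_constants B.structure_constants P Q)"
    using isomorphism_matrices_embedding[OF assms(1)]
      isomorphism_matrices_specialize[OF assms(1) A.finite_Basis B.finite_Basis]
    by blast
  finally show ?thesis .
qed

theorem corollary4p5:
  fixes \<iota>\<^sub>1 :: "'k::alg_closed_field \<Rightarrow> 'f1::field"
    and \<iota>\<^sub>2 :: "'k \<Rightarrow> 'f2::field"
    and scale\<^sub>A :: "'k \<Rightarrow> 'a::ab_group_add \<Rightarrow> 'a"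
    and mul\<^sub>A :: "'a \<Rightarrow> 'a \<Rightarrow> 'a"
    and scale\<^sub>B :: "'k \<Rightarrow> 'b::ab_group_add \<Rightarrow> 'b"
    and mul\<^sub>B :: "'b \<Rightarrow> 'b \<Rightarrow> 'b"
  assumes "field_embedding \<iota>\<^sub>1"
    and "field_embedding \<iota>\<^sub>2"
    and "nonassoc_algebra scale\<^sub>A mul\<^sub>A"
    and "finite_dimensional scale\<^sub>A"
    and "nonassoc_algebra scale\<^sub>B mul\<^sub>B"
    and "finite_dimensional scale\<^sub>B"
  shows "algebra_isomorphic (scalar_extension \<iota>\<^sub>1 scale\<^sub>A mul\<^sub>A) (scalar_extension \<iota>\<^sub>1 scale\<^sub>B mul\<^sub>B)
    \<longleftrightarrow> algebra_isomorphic (scalar_extension \<iota>\<^sub>2 scale\<^sub>A mul\<^sub>A) (scalar_extension \<iota>\<^sub>2 scale\<^sub>B mul\<^sub>B)"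
proof -
  obtain I where I: "finite_dimensional_vector_space scale\<^sub>A I"
    using assms(4) by (auto simp: finite_dimensional_def)
  obtain J where J: "finite_dimensional_vector_space scale\<^sub>B J"
    using assms(6) by (auto simp: finite_dimensional_def)
  have "algebra_with_basis scale\<^sub>A mul\<^sub>A I"
    using assms(3) I
    by (auto simp: algebra_with_basis_def algebra_with_basis_axioms_def
        finite_dimensional_vector_space_def finite_dimensional_vector_space_axioms_def)
  moreover have "algebra_with_basis scale\<^sub>B mul\<^sub>B J"
    using assms(5) J
    by (auto simp: algebra_with_basis_def algebra_with_basis_axioms_def
        finite_dimensional_vector_space_def finite_dimensional_vector_space_axioms_def)
  ultimately show ?thesis
    by (simp only: scalar_extensions_isomorphic_iff[OF assms(1)]
        scalar_extensions_isomorphic_iff[OF assms(2)])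
qed

end
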